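(* For $f(\bm{z})=\|\bm{\Omega}\bm{z}\|_1$ with $\bm{\Omega}\in\mathbb{R}^{p\times n}$, the error estimate $$\widehat{E}_p=\frac{2\sup_{\bm{s}\in\partial f(\bm{x})}\|\bm{s}\|_2}{f\left(\bm{x}/\|\bm{x}\|_2\right)},$$ whose denominator is $\|\bm{\Omega}\bm{x}\|_1/\|\bm{x}\|_2$, can become remarkably large for some specific signals $\bm{x}$ and analysis operators $\bm{\Omega}$: (a) (Fat $\bm{\Omega}$.) For fat $\bm{\Omega}\in\mathbb{R}^{p\times n}$, $\mathrm{null}(\bm{\Omega})$ is non-trivial, and one can choose $\bm{c}\in\mathbb{R}^n$ such that $\bm{P}_{\mathrm{null}(\bm{\Omega})}\bm{c}\neq\bm{0}$. If $$\bm{x}=\bm{P}_{\mathrm{null}(\bm{\Omega}_{\overline{\mathcal{S}}})}\bm{w}+\bm{P}_{\mathrm{null}(\bm{\Omega})}\bm{c},$$ where $\bm{w}\in\mathbb{R}^n$ is an arbitrary vector, then $$\frac{\|\bm{\Omega}\bm{x}\|_1}{\|\bm{x}\|_2}=\frac{\|\bm{\Omega}_{\mathcal{S}}\bm{P}_{\mathrm{null}(\bm{\Omega}_{\overline{\mathcal{S}}})}\bm{w}\|_1}{\|\bm{P}_{\mathrm{null}(\bm{\Omega}_{\overline{\mathcal{S}}})}\bm{w}+\bm{P}_{\mathrm{null}(\bm{\Omega})}\bm{c}\|_2}.$$ By increasing the norm of $\bm{c}$ using a scalar multiplier, this fraction decreases; in this way the denominator of $\widehat{E}_p$ can be made arbitrarily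 small (equivalently, the bound $\widehat{E}_p$ can be enlarged arbitrarily). (b) (Rank-deficient tall $\bm{\Omega}$.) Here too $\mathrm{null}(\bm{\Omega})$ is non-trivial, and the same approach makes $\widehat{E}_p$ arbitrarily large. (c) (Full-rank tall $\bm{\Omega}$.) There exist pairs $(\bm{\Omega},\bm{x})$ with $\bm{\Omega}$ tall and full-rank for which $\|\bm{\Omega}\bm{x}\|_1/\|\bm{x}\|_2$ is arbitrarily small. Specifically, let $|\mathcal{S}|>n$, $|\overline{\mathcal{S}}|<n$, $\sigma>0$, and let $$\bm{A}=\bm{U}\,\mathrm{diag}\{\underbrace{1,\dots,1}_{n-1\text{ times}},\sigma\}\,\bm{V}^T\in\mathbb{R}^{|\mathcal{S}|\times n},\qquad \bm{B}=[\bm{v}_1,\dots,\bm{v}_{|\overline{\mathcal{S}}|}]^T\in\mathbb{R}^{|\overline{\mathcal{S}}|\times n},$$ where $\bm{U}\in\mathbb{R}^{|\mathcal{S}|\times n}$ and $\bm{V}\in\mathbb{R}^{n\times n}$ are arbitrary incomplete and complete unitary matrices, respectively, with columns $\bm{u}_i$ and $\bm{v}_j$. Put $$\bm{\Omega}=\begin{bmatrix}\bm{A}\\ \bm{B}\end{bmatrix},\quad \bm{x}=\bm{v}_n,\quad \mathcal{S}=\{1,\dots,|\mathcal{S}|\},\quad \overline{\mathcal{S}}=\{|\mathcal{S}|+1,\dots,|\mathcal{S}|+|\overline{\mathcal{S}}|\}.$$ Then $\bm{\Omega}$ is full-rank, $\bm{x}\in\mathrm{null}(\bm{\Omega}_{\overline{\mathcal{S}}})$,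 and $$\frac{\|\bm{\Omega}\bm{x}\|_1}{\|\bm{x}\|_2}=\sigma\|\bm{u}_n\|_1,$$ so that reducing $\sigma$ while keeping the rest untouched makes this ratio arbitrarily small.
   Context: A matrix $\bm{\Omega}\in\mathbb{R}^{p\times n}$ is called tall if $p>n$ and fat if $p\le n$ (square matrices are included among the fat ones). $\mathcal{S}\subseteq\{1,\dots,p\}$ denotes the support of $\bm{\Omega}\bm{x}$ and $\overline{\mathcal{S}}$ its zero set (the complement of $\mathcal{S}$); $\bm{\Omega}_{\mathcal{S}}$ and $\bm{\Omega}_{\overline{\mathcal{S}}}$ are the sub-matrices of $\bm{\Omega}$ consisting of the rows indexed by $\mathcal{S}$ and $\overline{\mathcal{S}}$. For a subspace $\mathcal{C}\subseteq\mathbb{R}^n$, $\bm{P}_{\mathcal{C}}$ is the orthogonal projection onto $\mathcal{C}$; $\mathrm{null}(\cdot)$ denotes the null space; $\partial f(\bm{x})$ is the convex subdifferential. An "incomplete unitary" matrix is one with orthonormal columns that is not square. $\widehat{E}_p$ is a known upper bound (Amelunxen, Lotz, McCoy, Tropp) for $\inf_{t\ge0}\mathbb{E}\,\mathrm{dist}^2(\bm{g},t\,\partial f(\bm{x}))-\mathbb{E}\,\mathrm{dist}^2(\bm{g},\bigcup_{t\ge0}t\,\partial f(\bm{x}))$, where $\bm{g}$ is a standard Gaussian vector in $\mathbb{R}^n$ and $\mathrm{dist}$ is Euclidean distance to a set.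
   Formalization: In (a) a square Ω is assumed rank-deficient; the fraction decreases from some multiplier of c on (from 0 if ⟨Pw,Pc⟩≥0), strictly if its numerator is nonzero; Ê_p→∞ needs Ω≠0; in (c) the support of Ωx is only contained in S unless u_n has no zero entry. *)

theory Defs
  imports
    Complex_Main
    "HOL-Library.Extended_Real"
    "Jordan_Normal_Form.Matrix"
    "Jordan_Normal_Form.Matrix_Kernel"
    "Jordan_Normal_Form.DL_Rank"
    "Jordan_Normal_Form.DL_Submatrix"
begin

text \<open>Matrices and vectors are those of Jordan_Normal_Form, with dimensions as natural numbers;
  rows and columns are indexed from 0, so the index set of the rows of a \<open>p \<times> n\<close> matrix is
  \<open>{..<p}\<close> and the last column is column \<open>n - 1\<close>.\<close>

definition l1_norm :: "real vec \<Rightarrow> real" where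
  "l1_norm v = (\<Sum>i<dim_vec v. \<bar>v $ i\<bar>)"

definition l2_norm :: "real vec \<Rightarrow> real" where
  "l2_norm v = sqrt (v \<bullet> v)"

definition vec_support :: "real vec \<Rightarrow> nat set" where
  "vec_support v = {i. i < dim_vec v \<and> v $ i \<noteq> 0}"

definition fat_mat :: "real mat \<Rightarrow> bool" where
  "fat_mat A \<longleftrightarrow> dim_row A \<le> dim_col A"

definition tall_mat :: "real mat \<Rightarrow> bool" where
  "tall_mat A \<longleftrightarrow> dim_row A > dim_col A"

definition row_submatrix :: "real mat \<Rightarrow> nat set \<Rightarrow> real mat" where
  "row_submatrix A S = submatrix A S UNIV"

definition orth_proj :: "real vec set \<Rightarrow> real vec \<Rightarrow> real vec" where
  "orth_proj C w = (THE y. y \<in> C \<and> (\<forall>z\<in>C. (w - y) \<bullet> z = 0))"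

definition analysis_l1 :: "real mat \<Rightarrow> real vec \<Rightarrow> real" where
  "analysis_l1 A z = l1_norm (A *\<^sub>v z)"

definition subdifferential :: "nat \<Rightarrow> (real vec \<Rightarrow> real) \<Rightarrow> real vec \<Rightarrow> real vec set" where
  "subdifferential n f x =
     {s \<in> carrier_vec n. \<forall>z\<in>carrier_vec n. f z \<ge> f x + s \<bullet> (z - x)}"

text \<open>The value is an extended real, so that the supremum is never a junk value. If the denominator
  vanishes and the supremum is positive, the quotient is \<open>\<infinity>\<close>.\<close>

definition error_estimate :: "nat \<Rightarrow> (real vec \<Rightarrow> real) \<Rightarrow> real vec \<Rightarrow> ereal" where
  "error_estimate n f x =
     2 * (SUP s\<in>subdifferential n f x. ereal (l2_norm s))
       / ereal (f ((1 / l2_norm x) \<cdot>\<^sub>v x))"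

definition l1_l2_ratio :: "real mat \<Rightarrow> real vec \<Rightarrow> real" where
  "l1_l2_ratio A x = l1_norm (A *\<^sub>v x) / l2_norm x"

definition orthonormal_cols :: "real mat \<Rightarrow> bool" where
  "orthonormal_cols U \<longleftrightarrow> transpose_mat U * U = 1\<^sub>m (dim_col U)"

definition complete_unitary :: "nat \<Rightarrow> real mat \<Rightarrow> bool" where
  "complete_unitary n V \<longleftrightarrow> V \<in> carrier_mat n n \<and> orthonormal_cols V"

definition incomplete_unitary :: "nat \<Rightarrow> nat \<Rightarrow> real mat \<Rightarrow> bool" where
  "incomplete_unitary m n U \<longleftrightarrow> U \<in> carrier_mat m n \<and> m \<noteq> n \<and> orthonormal_cols U"

definition block_A :: "nat \<Rightarrow> real mat \<Rightarrow> real mat \<Rightarrow> real \<Rightarrow> real mat" where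
  "block_A n U V \<sigma> = U * mat_diag n (\<lambda>i. if i = n - 1 then \<sigma> else 1) * transpose_mat V"

definition block_B :: "nat \<Rightarrow> nat \<Rightarrow> real mat \<Rightarrow> real mat" where
  "block_B n k V = mat_of_rows n (map (col V) [0..<k])"

definition stacked_op :: "nat \<Rightarrow> nat \<Rightarrow> real mat \<Rightarrow> real mat \<Rightarrow> real \<Rightarrow> real mat" where
  "stacked_op n k U V \<sigma> = block_A n U V \<sigma> @\<^sub>r block_B n k V"

end

theory Submission
  imports Defs
begin

text \<open>Moving \<open>x\<close> along a direction \<open>d\<close> in the kernel of \<open>\<Omega>\<close> leaves \<open>\<Omega> x\<close> unchanged while the norm
  of \<open>x\<close> grows without bound, so the denominator of the estimate tends to \<open>0\<close>. The numerator does not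
  collapse: whether \<open>\<Omega>\<^sup>T y\<close> with \<open>\<bar>y\<^sub>i\<bar> \<le> 1\<close> and \<open>y\<^sub>i (\<Omega> x)\<^sub>i = \<bar>(\<Omega> x)\<^sub>i\<bar>\<close> is a subgradient
  depends on \<open>x\<close> only through \<open>\<Omega> x\<close>, so one nonzero subgradient serves the whole ray. For the stacked
  operator, \<open>\<Omega> v\<^sub>n\<close> is \<open>\<sigma> u\<^sub>n\<close> followed by zeros, and a subgradient can be chosen whose
  component along \<open>v\<^sub>1\<close> has modulus at least \<open>1\<close> for every \<open>\<sigma> > 0\<close>.\<close>

subsection \<open>Norms\<close>

lemma scalar_prod_self_nonneg: "0 \<le> v \<bullet> (v :: real vec)"
  unfolding scalar_prod_def by (intro sum_nonneg) simp

lemma scalar_prod_self_eq_0_iff: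
  fixes v :: "real vec"
  assumes "v \<in> carrier_vec n"
  shows "v \<bullet> v = 0 \<longleftrightarrow> v = 0\<^sub>v n"
proof
  assume "v \<bullet> v = 0"
  then have "\<forall>i<n. v $ i = 0"
    using assms unfolding scalar_prod_def by (subst (asm) sum_nonneg_eq_0_iff) auto
  then show "v = 0\<^sub>v n" using assms by auto
qed (use assms in auto)

lemma scalar_prod_self_pos:
  fixes v :: "real vec"
  assumes "v \<in> carrier_vec n" "v \<noteq> 0\<^sub>v n"
  shows "0 < v \<bullet> v"
  using scalar_prod_self_nonneg[of v] scalar_prod_self_eq_0_iff[OF assms(1)] assms(2) by linarith

lemma l2_norm_nonneg: "0 \<le> l2_norm v"
  unfolding l2_norm_def by (simp add: scalar_prod_self_nonneg)

lemma l2_norm_pos: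
  assumes "v \<in> carrier_vec n" "v \<noteq> 0\<^sub>v n"
  shows "0 < l2_norm v"
  unfolding l2_norm_def using scalar_prod_self_pos[OF assms] by simp

lemma l1_norm_nonneg: "0 \<le> l1_norm v"
  unfolding l1_norm_def by (simp add: sum_nonneg)

lemma l1_norm_smult: "l1_norm (a \<cdot>\<^sub>v v) = \<bar>a\<bar> * l1_norm v"
  unfolding l1_norm_def by (simp add: abs_mult sum_distrib_left)

lemma l1_norm_eq_0_iff:
  assumes "v \<in> carrier_vec n"
  shows "l1_norm v = 0 \<longleftrightarrow> v = 0\<^sub>v n"
  using assms unfolding l1_norm_def by (subst sum_nonneg_eq_0_iff) auto

lemma l1_l2_ratio_nonneg: "0 \<le> l1_l2_ratio A x"
  unfolding l1_l2_ratio_def by (simp add: l1_norm_nonneg l2_norm_nonneg)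

text \<open>Cauchy-Schwarz against a unit vector: the residual
  \<open>s - ?c \<cdot>\<^sub>v e\<close> has squared length
  \<open>s \<bullet> s - ?c\<^sup>2\<close>. It bounds the norm of a subgradient from below by a
  single component.\<close>

lemma abs_scalar_prod_unit_le:
  assumes s: "s \<in> carrier_vec n" and e: "e \<in> carrier_vec n" and "e \<bullet> e = 1"
  shows "\<bar>s \<bullet> e\<bar> \<le> l2_norm s"
proof -
  let ?c = "s \<bullet> e"
  have "0 \<le> (s - ?c \<cdot>\<^sub>v e) \<bullet> (s - ?c \<cdot>\<^sub>v e)"
    by (rule scalar_prod_self_nonneg)
  also have "\<dots> = s \<bullet> s - ?c\<^sup>2"
    using assms comm_scalar_prod[OF e s]
    by (simp add: minus_scalar_prod_distrib[of _ n] scalar_prod_minus_distrib[of _ n]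
        power2_eq_square)
  finally have "?c\<^sup>2 \<le> s \<bullet> s" by simp
  then show ?thesis unfolding l2_norm_def using real_le_rsqrt by force
qed

text \<open>Positive homogeneity of the l1 norm. At \<open>x = 0\<close> both sides are 0, because
  division by zero yields 0.\<close>

lemma analysis_l1_normalized:
  assumes "A \<in> carrier_mat p n" "x \<in> carrier_vec n"
  shows "analysis_l1 A ((1 / l2_norm x) \<cdot>\<^sub>v x) = l1_l2_ratio A x"
  unfolding analysis_l1_def l1_l2_ratio_def
  by (simp add: mult_mat_vec[OF assms] l1_norm_smult l2_norm_nonneg)

subsection \<open>Subgradients and the error estimate\<close>

text \<open>The vector \<open>y\<close> is a subgradient of the l1 norm at the image of
  \<open>x\<close>. After moving the transpose across the scalar product, \<open>le\<close> bounds
  the pairing of \<open>y\<close> with the image of \<open>z\<close> by the l1 norm, while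
  \<open>sgn\<close> makes the pairing with the image of \<open>x\<close> attain it.\<close>

lemma transpose_mult_in_subdifferential:
  assumes A: "A \<in> carrier_mat p n" and x: "x \<in> carrier_vec n" and y: "y \<in> carrier_vec p"
    and le: "\<And>i. i < p \<Longrightarrow> \<bar>y $ i\<bar> \<le> 1"
    and sgn: "\<And>i. i < p \<Longrightarrow> y $ i * (A *\<^sub>v x) $ i = \<bar>(A *\<^sub>v x) $ i\<bar>"
  shows "transpose_mat A *\<^sub>v y \<in> subdifferential n (analysis_l1 A) x"
proof -
  have "analysis_l1 A x + (transpose_mat A *\<^sub>v y) \<bullet> (z - x) \<le> analysis_l1 A z"
    if z: "z \<in> carrier_vec n" for z
  proof -
    have "(transpose_mat A *\<^sub>v y) \<bullet> (z - x) = y \<bullet> (A *\<^sub>v (z - x))"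
      by (rule transpose_vec_mult_scalar[OF A _ y]) (use x z in auto)
    also have "\<dots> = y \<bullet> (A *\<^sub>v z) - y \<bullet> (A *\<^sub>v x)"
      using A x y z by (simp add: mult_minus_distrib_mat_vec[OF A] scalar_prod_minus_distrib[of _ p])
    also have "y \<bullet> (A *\<^sub>v x) = analysis_l1 A x"
      unfolding analysis_l1_def l1_norm_def scalar_prod_def using A sgn
      by (intro sum.cong) (auto simp del: index_mult_mat_vec)
    finally have "(transpose_mat A *\<^sub>v y) \<bullet> (z - x) = y \<bullet> (A *\<^sub>v z) - analysis_l1 A x" .
    moreover have "y \<bullet> (A *\<^sub>v z) \<le> analysis_l1 A z"
      unfolding analysis_l1_def l1_norm_def scalar_prod_def atLeast0LessThan
    proof (rule sum_mono)
      fix i assume "i \<in> {..<dim_vec (A *\<^sub>v z)}"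
      then have "\<bar>y $ i\<bar> * \<bar>(A *\<^sub>v z) $ i\<bar> \<le> 1 * \<bar>(A *\<^sub>v z) $ i\<bar>"
        using A le by (intro mult_right_mono) auto
      then show "y $ i * (A *\<^sub>v z) $ i \<le> \<bar>(A *\<^sub>v z) $ i\<bar>"
        by (metis abs_ge_self abs_mult mult_1 order_trans)
    qed
    ultimately show ?thesis by simp
  qed
  then show ?thesis
    unfolding subdifferential_def using A y by auto
qed

text \<open>One subgradient of known length bounds the supremum from below, so the supremum itself
  never has to be computed.\<close>

lemma error_estimate_ge:
  assumes "A \<in> carrier_mat p n" "x \<in> carrier_vec n"
    and "s \<in> subdifferential n (analysis_l1 A) x" "\<delta> \<le> l2_norm s"
  shows "ereal (2 * \<delta>) / ereal (l1_l2_ratio A x) \<le> error_estimate n (analysis_l1 A) x"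
proof -
  have "ereal \<delta> \<le> (SUP s\<in>subdifferential n (analysis_l1 A) x. ereal (l2_norm s))"
    using assms by (intro SUP_upper2[of s]) auto
  then have "2 * ereal \<delta> \<le> 2 * (SUP s\<in>subdifferential n (analysis_l1 A) x. ereal (l2_norm s))"
    by (intro ereal_mult_left_mono) auto
  \<comment> \<open>This includes a vanishing ratio, whose inverse in \<open>ereal\<close> is
    \<infinity>.\<close>
  moreover have "0 \<le> inverse (ereal (l1_l2_ratio A x))"
    using l1_l2_ratio_nonneg[of A x] by (simp add: ereal_inverse_nonneg_iff)
  ultimately show ?thesis
    unfolding error_estimate_def analysis_l1_normalized[OF assms(1,2)] divide_ereal_def
    by (metis ereal_mult_right_mono numeral_eq_ereal times_ereal.simps(1))
qed

text \<open>A vanishing ratio is not excluded here: then the quotient is \<open>\<infinity>\<close>, because \<open>\<delta> > 0\<close>.\<close>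

lemma error_estimate_tendsto_infinity:
  assumes "\<And>t. A t \<in> carrier_mat p n" "\<And>t. x t \<in> carrier_vec n" and \<delta>: "0 < \<delta>"
    and s: "\<forall>\<^sub>F t in F. \<exists>s\<in>subdifferential n (analysis_l1 (A t)) (x t). \<delta> \<le> l2_norm s"
    and lim: "((\<lambda>t. l1_l2_ratio (A t) (x t)) \<longlongrightarrow> 0) F"
  shows "((\<lambda>t. error_estimate n (analysis_l1 (A t)) (x t)) \<longlongrightarrow> \<infinity>) F"
  unfolding tendsto_PInfty
proof
  fix r :: real
  \<comment> \<open>Using \<open>\<bar>r\<bar> + 1\<close> in place of \<open>r\<close> keeps the
    threshold positive for every real \<open>r\<close>, including zero and negative ones.\<close>
  have "0 < 2 * \<delta> / (\<bar>r\<bar> + 1)" using \<delta> by (simp add: add_nonneg_pos)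
  with lim have "\<forall>\<^sub>F t in F. l1_l2_ratio (A t) (x t) < 2 * \<delta> / (\<bar>r\<bar> + 1)"
    by (rule order_tendstoD)
  with s show "\<forall>\<^sub>F t in F. ereal r < error_estimate n (analysis_l1 (A t)) (x t)"
  proof eventually_elim
    case (elim t)
    let ?q = "l1_l2_ratio (A t) (x t)"
    have "ereal r < ereal (2 * \<delta>) / ereal ?q"
    proof (cases "?q = 0")
      case True
      then show ?thesis using \<delta> by (simp add: divide_ereal_def)
    next
      case False
      then have "0 < ?q" using l1_l2_ratio_nonneg[of "A t" "x t"] by simp
      have "r * ?q \<le> (\<bar>r\<bar> + 1) * ?q"
        using \<open>0 < ?q\<close> by (intro mult_right_mono) auto
      also have "\<dots> < 2 * \<delta>"
        using elim(2) by (simp add: pos_less_divide_eq add_nonneg_pos mult.commute)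
      finally show ?thesis using \<open>0 < ?q\<close> by (simp add: pos_less_divide_eq)
    qed
    also have "\<dots> \<le> error_estimate n (analysis_l1 (A t)) (x t)"
      using elim(1) error_estimate_ge[OF assms(1,2)] by blast
    finally show ?case .
  qed
qed

subsection \<open>Orthogonal projection onto a kernel\<close>

text \<open>Uniqueness for the definite description: the difference of two candidates lies in the
  kernel and is orthogonal to the kernel, hence to itself. Later values of \<open>orth_proj\<close>
  are found by checking these two conditions.\<close>

lemma orth_proj_mat_kernel_eqI:
  assumes A: "A \<in> carrier_mat p n" and w: "w \<in> carrier_vec n"
    and y: "y \<in> mat_kernel A" and orth: "\<And>z. z \<in> mat_kernel A \<Longrightarrow> (w - y) \<bullet> z = 0"
  shows "orth_proj (mat_kernel A) w = y"
  unfolding orth_proj_def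
proof (rule the_equality)
  fix y' assume y': "y' \<in> mat_kernel A \<and> (\<forall>z\<in>mat_kernel A. (w - y') \<bullet> z = 0)"
  have c: "y \<in> carrier_vec n" "y' \<in> carrier_vec n"
    using y y' A by (auto simp: mat_kernel[OF A])
  have ker: "y - y' \<in> mat_kernel A"
    using y y' c by (auto simp: mat_kernel[OF A] mult_minus_distrib_mat_vec[OF A])
  have "(y - y') \<bullet> (y - y') = (w - y') \<bullet> (y - y') - (w - y) \<bullet> (y - y')"
    using c w by (simp add: minus_scalar_prod_distrib[of _ n] scalar_prod_minus_distrib[of _ n])
  also have "\<dots> = 0" using orth[OF ker] y' ker by simp
  finally have d: "y - y' = 0\<^sub>v n" using c by (simp add: scalar_prod_self_eq_0_iff[of _ n])
  show "y' = y"
  proof (rule eq_vecI)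
    fix i assume "i < dim_vec y"
    then have "(y - y') $ i = 0" using d c by simp
    then show "y' $ i = y $ i" using \<open>i < dim_vec y\<close> c by simp
  qed (use c in simp)
qed (use y orth in blast)

text \<open>The kernel is the intersection of the hyperplanes orthogonal to the rows; adding a row \<open>a\<close>
  changes the projection by a multiple of the projection of \<open>a\<close>.\<close>

lemma orthogonal_decomposition_rows:
  fixes A :: "real mat"
  assumes A: "A \<in> carrier_mat p n" and "k \<le> p" and "w \<in> carrier_vec n"
  shows "\<exists>y\<in>carrier_vec n. (\<forall>i<k. row A i \<bullet> y = 0) \<and>
    (\<forall>z\<in>carrier_vec n. (\<forall>i<k. row A i \<bullet> z = 0) \<longrightarrow> (w - y) \<bullet> z = 0)"
  using assms(2,3)
proof (induction k arbitrary: w)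
  case 0
  then show ?case by (intro bexI[of _ w]) (auto simp: minus_scalar_prod_distrib[of _ n])
next
  case (Suc k)
  define a where "a = row A k"
  have a: "a \<in> carrier_vec n" using A Suc.prems unfolding a_def by auto
  obtain y where y: "y \<in> carrier_vec n" "\<And>i. i < k \<Longrightarrow> row A i \<bullet> y = 0"
    "\<And>z. z \<in> carrier_vec n \<Longrightarrow> (\<forall>i<k. row A i \<bullet> z = 0) \<Longrightarrow> (w - y) \<bullet> z = 0"
    using Suc.IH[of w] Suc.prems by auto
  obtain b where b: "b \<in> carrier_vec n" "\<And>i. i < k \<Longrightarrow> row A i \<bullet> b = 0"
    "\<And>z. z \<in> carrier_vec n \<Longrightarrow> (\<forall>i<k. row A i \<bullet> z = 0) \<Longrightarrow> (a - b) \<bullet> z = 0"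
    using Suc.IH[of a] Suc.prems a by auto
  \<comment> \<open>On vectors orthogonal to the earlier rows, the new row acts like its projection
    \<open>b\<close>, which is itself such a vector.\<close>
  have ab: "a \<bullet> z = b \<bullet> z" if "z \<in> carrier_vec n" "\<forall>i<k. row A i \<bullet> z = 0" for z
    using b(3)[OF that] a b(1) that(1) by (simp add: minus_scalar_prod_distrib[of _ n])
  \<comment> \<open>This coefficient makes \<open>y - c \<cdot>\<^sub>v b\<close> orthogonal to
    \<open>b\<close>, hence to \<open>a\<close>. If \<open>b\<close> is zero, then \<open>c\<close>
    is 0 by the division convention, and \<open>y\<close> is already orthogonal to
    \<open>a\<close>.\<close>
  define c where "c = (b \<bullet> y) / (b \<bullet> b)"
  have c: "c * (b \<bullet> b) = b \<bullet> y"
  proof (cases "b \<bullet> b = 0")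
    case True
    then have "b = 0\<^sub>v n" using b(1) by (simp add: scalar_prod_self_eq_0_iff)
    then show ?thesis using y(1) by simp
  qed (simp add: c_def)
  have rows: "row A i \<in> carrier_vec n" if "i \<le> k" for i
    using A Suc.prems that by auto
  show ?case
  proof (intro bexI[of _ "y - c \<cdot>\<^sub>v b"] conjI allI impI ballI)
    show "y - c \<cdot>\<^sub>v b \<in> carrier_vec n" using y b by simp
    show "row A i \<bullet> (y - c \<cdot>\<^sub>v b) = 0" if "i < Suc k" for i
    proof (cases "i = k")
      case True
      then have "row A i \<bullet> (y - c \<cdot>\<^sub>v b) = a \<bullet> y - c * (a \<bullet> b)"
        using a y b unfolding a_def by (simp add: scalar_prod_minus_distrib[of _ n])
      also have "\<dots> = 0" using ab[of y] ab[of b] y b c by simp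
      finally show ?thesis .
    next
      case False
      then show ?thesis
        using that y b rows[of i] by (simp add: scalar_prod_minus_distrib[of _ n])
    qed
    show "(w - (y - c \<cdot>\<^sub>v b)) \<bullet> z = 0"
      if z: "z \<in> carrier_vec n" "\<forall>i<Suc k. row A i \<bullet> z = 0" for z
    proof -
      have "(w - (y - c \<cdot>\<^sub>v b)) \<bullet> z = (w - y) \<bullet> z + c * (b \<bullet> z)"
        using z y b Suc.prems by (simp add: minus_scalar_prod_distrib[of _ n])
      moreover have "a \<bullet> z = 0" using z unfolding a_def by simp
      ultimately show ?thesis using y(3)[of z] ab[of z] z by simp
    qed
  qed
qed

lemma mat_kernel_iff_rows:
  assumes "A \<in> carrier_mat p n"
  shows "v \<in> mat_kernel A \<longleftrightarrow> v \<in> carrier_vec n \<and> (\<forall>i<p. row A i \<bullet> v = 0)"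
proof -
  have "A *\<^sub>v v = 0\<^sub>v p \<longleftrightarrow> (\<forall>i<p. row A i \<bullet> v = 0)"
    using assms by (subst vec_eq_iff) simp
  then show ?thesis by (simp add: mat_kernel[OF assms])
qed

text \<open>Existence of the decomposition, with all rows taken into account, turns the definite
  description into an actual projection.\<close>

lemma
  assumes A: "A \<in> carrier_mat p n" and w: "w \<in> carrier_vec n"
  shows orth_proj_in_mat_kernel: "orth_proj (mat_kernel A) w \<in> mat_kernel A"
    and orth_proj_mat_kernel_orthogonal:
      "z \<in> mat_kernel A \<Longrightarrow> (w - orth_proj (mat_kernel A) w) \<bullet> z = 0"
proof -
  obtain y where y: "y \<in> mat_kernel A" and orth: "\<And>z. z \<in> mat_kernel A \<Longrightarrow> (w - y) \<bullet> z = 0"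
    using orthogonal_decomposition_rows[OF A order_refl w]
    unfolding mat_kernel_iff_rows[OF A] by blast
  have eq: "orth_proj (mat_kernel A) w = y"
    by (rule orth_proj_mat_kernel_eqI[OF A w y orth])
  show "orth_proj (mat_kernel A) w \<in> mat_kernel A"
    unfolding eq by (rule y)
  show "z \<in> mat_kernel A \<Longrightarrow> (w - orth_proj (mat_kernel A) w) \<bullet> z = 0"
    unfolding eq by (rule orth)
qed

lemma orth_proj_mat_kernel_id:
  assumes A: "A \<in> carrier_mat p n" and w: "w \<in> mat_kernel A"
  shows "orth_proj (mat_kernel A) w = w"
proof (rule orth_proj_mat_kernel_eqI[OF A _ w])
  show c: "w \<in> carrier_vec n" by (rule mat_kernelD(1)[OF A w])
  show "(w - w) \<bullet> z = 0" if "z \<in> mat_kernel A" for z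
    using c mat_kernelD(1)[OF A that] by simp
qed

text \<open>Homogeneity means that scaling \<open>c\<close> moves the signal along a straight ray,
  whose direction is the projection of \<open>c\<close>.\<close>

lemma orth_proj_mat_kernel_smult:
  assumes A: "A \<in> carrier_mat p n" and w: "w \<in> carrier_vec n"
  shows "orth_proj (mat_kernel A) (t \<cdot>\<^sub>v w) = t \<cdot>\<^sub>v orth_proj (mat_kernel A) w"
proof (rule orth_proj_mat_kernel_eqI[OF A])
  let ?y = "orth_proj (mat_kernel A) w"
  have y: "?y \<in> mat_kernel A" by (rule orth_proj_in_mat_kernel[OF A w])
  then have c: "?y \<in> carrier_vec n" using mat_kernel[OF A] by auto
  show "t \<cdot>\<^sub>v ?y \<in> mat_kernel A" by (rule mat_kernel_smult[OF A y])
  show "(t \<cdot>\<^sub>v w - t \<cdot>\<^sub>v ?y) \<bullet> z = 0" if z: "z \<in> mat_kernel A" for z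
  proof -
    have zc: "z \<in> carrier_vec n" by (rule mat_kernelD(1)[OF A z])
    have "w \<bullet> z = ?y \<bullet> z"
      using orth_proj_mat_kernel_orthogonal[OF A w z] w c zc
      by (simp add: minus_scalar_prod_distrib[of _ n])
    then show ?thesis using w c zc by (simp add: minus_scalar_prod_distrib[of _ n])
  qed
qed (use w in simp)

subsection \<open>Submatrices of rows\<close>

text \<open>\<open>pick S\<close> enumerates \<open>S\<close> increasingly, so it is injective, and
  its image is a subset of \<open>S\<close> of full cardinality. Sums over the rows of a submatrix
  can then be reindexed as sums over \<open>S\<close>.\<close>

lemma bij_betw_pick:
  assumes "finite S"
  shows "bij_betw (pick S) {..<card S} S"
proof -
  have inj: "inj_on (pick S) {..<card S}"
    by (intro inj_onI) (metis lessThan_iff less_irrefl linorder_neqE_nat pick_mono_le)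
  moreover have "pick S ` {..<card S} = S"
    using assms pick_in_set_le card_image[OF inj] by (intro card_subset_eq) auto
  ultimately show ?thesis unfolding bij_betw_def by simp
qed

lemma row_submatrix_carrier:
  assumes "A \<in> carrier_mat p n" "S \<subseteq> {..<p}"
  shows "row_submatrix A S \<in> carrier_mat (card S) n"
proof -
  have "{i. i < p \<and> i \<in> S} = S" using assms(2) by auto
  then show ?thesis
    using assms(1) unfolding row_submatrix_def carrier_mat_def by (simp add: dim_submatrix)
qed

lemma row_submatrix_mult_vec:
  assumes A: "A \<in> carrier_mat p n" and S: "S \<subseteq> {..<p}" and v: "v \<in> carrier_vec n"
  shows "row_submatrix A S *\<^sub>v v = vec (card S) (\<lambda>i. (A *\<^sub>v v) $ pick S i)"
proof (rule eq_vecI)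
  note B = row_submatrix_carrier[OF A S]
  have [simp]: "{i. i < p \<and> i \<in> S} = S" using S by auto
  fix i assume "i < dim_vec (vec (card S) (\<lambda>i. (A *\<^sub>v v) $ pick S i))"
  then have i: "i < card S" by simp
  then have pick: "pick S i < p" using pick_in_set_le[of i S] S by auto
  have "row (row_submatrix A S) i = row A (pick S i)"
    using A B i pick unfolding row_submatrix_def
    by (intro eq_vecI) (auto simp: submatrix_index pick_UNIV)
  then show "(row_submatrix A S *\<^sub>v v) $ i = vec (card S) (\<lambda>i. (A *\<^sub>v v) $ pick S i) $ i"
    using A B i pick by simp
qed (use row_submatrix_carrier[OF A S] in simp)

lemma l1_norm_row_submatrix:
  assumes A: "A \<in> carrier_mat p n" and S: "S \<subseteq> {..<p}" and v: "v \<in> carrier_vec n"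
  shows "l1_norm (row_submatrix A S *\<^sub>v v) = (\<Sum>i\<in>S. \<bar>(A *\<^sub>v v) $ i\<bar>)"
proof -
  have "finite S" using S finite_subset by blast
  then show ?thesis
    unfolding row_submatrix_mult_vec[OF assms] l1_norm_def
    using sum.reindex_bij_betw[OF bij_betw_pick, of S "\<lambda>i. \<bar>(A *\<^sub>v v) $ i\<bar>"] by simp
qed

text \<open>A vector is zero exactly when its l1 norm is, so the sum formula above settles the claim
  without another look at \<open>pick\<close>.\<close>

lemma mat_kernel_row_submatrix_iff:
  assumes A: "A \<in> carrier_mat p n" and S: "S \<subseteq> {..<p}"
  shows "v \<in> mat_kernel (row_submatrix A S) \<longleftrightarrow>
    v \<in> carrier_vec n \<and> (\<forall>i\<in>S. (A *\<^sub>v v) $ i = 0)"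
proof (cases "v \<in> carrier_vec n")
  case True
  have "finite S" using S finite_subset by blast
  then have "l1_norm (row_submatrix A S *\<^sub>v v) = 0 \<longleftrightarrow> (\<forall>i\<in>S. (A *\<^sub>v v) $ i = 0)"
    unfolding l1_norm_row_submatrix[OF A S True] by (subst sum_nonneg_eq_0_iff) auto
  moreover have "row_submatrix A S *\<^sub>v v \<in> carrier_vec (card S)"
    using row_submatrix_carrier[OF A S] True by auto
  ultimately show ?thesis
    using True by (simp add: mat_kernel[OF row_submatrix_carrier[OF A S]] l1_norm_eq_0_iff)
qed (simp add: mat_kernel[OF row_submatrix_carrier[OF A S]])

subsection \<open>Rank and kernel\<close>

text \<open>A trivial kernel makes the columns linearly independent, which gives the rank and,
  inside a space of dimension \<open>p\<close>, the bound on \<open>n\<close>. Distinctness is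
  proved separately because independence concerns the set of columns, where a repetition would go
  unnoticed; the difference of two unit vectors detects it.\<close>

lemma
  fixes A :: "real mat"
  assumes A: "A \<in> carrier_mat p n" and ker: "mat_kernel A = {0\<^sub>v n}"
  shows rank_eq_if_trivial_kernel: "vec_space.rank p A = n"
    and le_if_trivial_kernel: "n \<le> p"
proof -
  interpret vec_space "TYPE(real)" p .
  have dist: "distinct (cols A)"
    unfolding distinct_conv_nth
  proof (intro allI impI)
    fix i j assume ij: "i < length (cols A)" "j < length (cols A)" "i \<noteq> j"
    have "unit_vec n i - unit_vec n j \<noteq> (0\<^sub>v n :: real vec)"
    proof
      assume "unit_vec n i - unit_vec n j = (0\<^sub>v n :: real vec)"
      then have "(unit_vec n i - unit_vec n j) $ i = (0\<^sub>v n :: real vec) $ i" by simp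
      then show False using ij A by simp
    qed
    then have "A *\<^sub>v (unit_vec n i - unit_vec n j) \<noteq> 0\<^sub>v p"
      using ker mat_kernelI[OF A, of "unit_vec n i - unit_vec n j"] by auto
    moreover have "A *\<^sub>v (unit_vec n i - unit_vec n j) = col A i - col A j"
      using ij A by (intro eq_vecI)
        (auto simp: mult_minus_distrib_mat_vec[OF A] scalar_prod_minus_distrib[of _ n])
    ultimately show "cols A ! i \<noteq> cols A ! j" using ij A by auto
  qed
  have indpt: "lin_indpt (set (cols A))"
  proof
    assume "lin_dep (set (cols A))"
    then obtain v where "v \<in> carrier_vec n" "v \<noteq> 0\<^sub>v n" "A *\<^sub>v v = 0\<^sub>v p"
      using lin_depE[OF A _ dist] by blast
    then show False using ker mat_kernelI[OF A] by auto
  qed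
  show "rank A = n" by (rule lin_indpt_full_rank[OF A dist indpt])
  have "card (set (cols A)) \<le> dim"
    using cols_dim[of A] A by (intro li_le_dim(2)) (auto simp: indpt)
  then show "n \<le> p" using distinct_card[OF dist] A dim_is_n by simp
qed

subsection \<open>Rays in the direction of the kernel\<close>

text \<open>The nested form of the quadratic in \<open>t\<close> suits the limit argument below,
  which multiplies two factors that tend to infinity.\<close>

lemma scalar_prod_self_line:
  fixes u d :: "real vec"
  assumes "u \<in> carrier_vec n" "d \<in> carrier_vec n"
  shows "(u + t \<cdot>\<^sub>v d) \<bullet> (u + t \<cdot>\<^sub>v d) = u \<bullet> u + t * (2 * (u \<bullet> d) + t * (d \<bullet> d))"
  using assms comm_scalar_prod[OF assms]
  by (simp add: add_scalar_prod_distrib[of _ n] scalar_prod_add_distrib[of _ n] algebra_simps)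

text \<open>The squared norm is a parabola in the parameter with vertex at
  \<open>- (u \<bullet> d) / (d \<bullet> d)\<close>. The difference of its values at
  \<open>t\<close> and \<open>s\<close> has the factor \<open>t - s\<close>, and the cofactor is
  positive to the right of the vertex.\<close>

lemma l2_norm_line_strict_mono:
  assumes u: "u \<in> carrier_vec n" and d: "d \<in> carrier_vec n" "d \<noteq> 0\<^sub>v n"
    and s: "- (u \<bullet> d) / (d \<bullet> d) \<le> s" and st: "s < t"
  shows "l2_norm (u + s \<cdot>\<^sub>v d) < l2_norm (u + t \<cdot>\<^sub>v d)"
proof -
  have dd: "0 < d \<bullet> d" by (rule scalar_prod_self_pos[OF d])
  then have "0 \<le> u \<bullet> d + s * (d \<bullet> d)"
    using s pos_divide_le_eq[OF dd, of "- (u \<bullet> d)" s] by linarith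
  moreover have "s * (d \<bullet> d) < t * (d \<bullet> d)" using st dd by simp
  ultimately have "0 < 2 * (u \<bullet> d) + (s + t) * (d \<bullet> d)"
    by (simp add: distrib_right)
  then have "0 < (t - s) * (2 * (u \<bullet> d) + (s + t) * (d \<bullet> d))" using st by simp
  then show ?thesis
    unfolding l2_norm_def scalar_prod_self_line[OF u d(1)] by (simp add: algebra_simps)
qed

lemma filterlim_l2_norm_line:
  assumes u: "u \<in> carrier_vec n" and d: "d \<in> carrier_vec n" "d \<noteq> 0\<^sub>v n"
  shows "filterlim (\<lambda>t. l2_norm (u + t \<cdot>\<^sub>v d)) at_top at_top"
proof -
  have "0 < d \<bullet> d" by (rule scalar_prod_self_pos[OF d])
  then have "filterlim (\<lambda>t. t * (d \<bullet> d)) at_top at_top"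
    by (intro filterlim_at_top_mult_tendsto_pos[OF tendsto_const _ filterlim_ident])
  then have "filterlim (\<lambda>t. 2 * (u \<bullet> d) + t * (d \<bullet> d)) at_top at_top"
    by (intro filterlim_tendsto_add_at_top[OF tendsto_const])
  then have "filterlim (\<lambda>t. t * (2 * (u \<bullet> d) + t * (d \<bullet> d))) at_top at_top"
    by (intro filterlim_at_top_mult_at_top filterlim_ident)
  then have "filterlim (\<lambda>t. u \<bullet> u + t * (2 * (u \<bullet> d) + t * (d \<bullet> d))) at_top at_top"
    by (intro filterlim_tendsto_add_at_top[OF tendsto_const])
  then show ?thesis
    unfolding l2_norm_def scalar_prod_self_line[OF u d(1)]
    by (rule filterlim_compose[OF sqrt_at_top])
qed

lemma mult_kernel_line:
  fixes A :: "real mat"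
  assumes A: "A \<in> carrier_mat p n" and u: "u \<in> carrier_vec n" and d: "d \<in> mat_kernel A"
  shows "A *\<^sub>v (u + t \<cdot>\<^sub>v d) = A *\<^sub>v u"
proof -
  note [simp] = mat_kernelD[OF A d]
  have [simp]: "t \<cdot>\<^sub>v 0\<^sub>v p = 0\<^sub>v p" by auto
  show ?thesis
    using A u by (simp add: mult_add_distrib_mat_vec[OF A] mult_mat_vec[OF A])
qed

lemma l1_l2_ratio_kernel_line:
  assumes "A \<in> carrier_mat p n" "u \<in> carrier_vec n" "d \<in> mat_kernel A"
  shows "l1_l2_ratio A (u + t \<cdot>\<^sub>v d) = l1_norm (A *\<^sub>v u) / l2_norm (u + t \<cdot>\<^sub>v d)"
  unfolding l1_l2_ratio_def mult_kernel_line[OF assms] ..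

lemma l1_l2_ratio_kernel_line_tendsto_0:
  assumes A: "A \<in> carrier_mat p n" and u: "u \<in> carrier_vec n"
    and d: "d \<in> mat_kernel A" "d \<noteq> 0\<^sub>v n"
  shows "((\<lambda>t. l1_l2_ratio A (u + t \<cdot>\<^sub>v d)) \<longlongrightarrow> 0) at_top"
  unfolding l1_l2_ratio_kernel_line[OF A u d(1)]
  by (intro real_tendsto_divide_at_top[OF tendsto_const]
      filterlim_l2_norm_line[OF u mat_kernelD(1)[OF A d(1)] d(2)])

text \<open>The numerator is constant along the line while the denominator grows. If
  \<open>u\<close> is mapped to zero, both ratios are 0, so only the weak inequality holds in
  general.\<close>

lemma l1_l2_ratio_kernel_line_mono:
  assumes A: "A \<in> carrier_mat p n" and u: "u \<in> carrier_vec n"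
    and d: "d \<in> mat_kernel A" "d \<noteq> 0\<^sub>v n"
    and s: "- (u \<bullet> d) / (d \<bullet> d) \<le> s" and st: "s < t"
  shows "l1_l2_ratio A (u + t \<cdot>\<^sub>v d) \<le> l1_l2_ratio A (u + s \<cdot>\<^sub>v d)"
    and "A *\<^sub>v u \<noteq> 0\<^sub>v p \<Longrightarrow> l1_l2_ratio A (u + t \<cdot>\<^sub>v d) < l1_l2_ratio A (u + s \<cdot>\<^sub>v d)"
proof -
  note dc = mat_kernelD(1)[OF A d(1)]
  have less: "l2_norm (u + s \<cdot>\<^sub>v d) < l2_norm (u + t \<cdot>\<^sub>v d)"
    by (rule l2_norm_line_strict_mono[OF u dc d(2) s st])
  show strict: "l1_l2_ratio A (u + t \<cdot>\<^sub>v d) < l1_l2_ratio A (u + s \<cdot>\<^sub>v d)"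
    if ne: "A *\<^sub>v u \<noteq> 0\<^sub>v p"
  proof -
    \<comment> \<open>At the zero vector the ratio would be 0 by the division convention and strict
      decrease would fail; a nonzero image rules this out.\<close>
    have "u + s \<cdot>\<^sub>v d \<noteq> 0\<^sub>v n"
    proof
      assume "u + s \<cdot>\<^sub>v d = 0\<^sub>v n"
      then have "A *\<^sub>v u = A *\<^sub>v 0\<^sub>v n" using mult_kernel_line[OF A u d(1), of s] by simp
      also have "\<dots> = 0\<^sub>v p" using A by (intro eq_vecI) auto
      finally show False using ne by simp
    qed
    then have "0 < l2_norm (u + s \<cdot>\<^sub>v d)" using u dc by (intro l2_norm_pos[of _ n]) auto
    moreover have "0 < l1_norm (A *\<^sub>v u)"
      using ne A u l1_norm_nonneg[of "A *\<^sub>v u"] l1_norm_eq_0_iff[of "A *\<^sub>v u" p]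
      by (simp add: less_le)
    ultimately show ?thesis
      unfolding l1_l2_ratio_kernel_line[OF A u d(1)] using less
      by (intro divide_strict_left_mono) auto
  qed
  show "l1_l2_ratio A (u + t \<cdot>\<^sub>v d) \<le> l1_l2_ratio A (u + s \<cdot>\<^sub>v d)"
  proof (cases "A *\<^sub>v u = 0\<^sub>v p")
    case True
    then have "l1_norm (A *\<^sub>v u) = 0" using l1_norm_eq_0_iff[of "0\<^sub>v p" p] by simp
    then show ?thesis unfolding l1_l2_ratio_kernel_line[OF A u d(1)] by simp
  qed (use strict in simp)
qed

text \<open>Pulling back the sign vector of the image of some \<open>z\<close> outside the kernel
  gives \<open>s\<close> whose pairing with \<open>z\<close> is the nonzero l1 norm of that
  image.\<close>

lemma exists_nonzero_subgradient:
  assumes A: "A \<in> carrier_mat p n" "A \<noteq> 0\<^sub>m p n" and u: "u \<in> carrier_vec n"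
  shows "\<exists>s\<in>carrier_vec n. s \<noteq> 0\<^sub>v n \<and>
    (\<forall>x\<in>carrier_vec n. A *\<^sub>v x = A *\<^sub>v u \<longrightarrow> s \<in> subdifferential n (analysis_l1 A) x)"
proof -
  obtain i j where ij: "i < p" "j < n" "A $$ (i, j) \<noteq> 0"
    using A by (metis carrier_matD eq_matI index_zero_mat)
  have "(A *\<^sub>v unit_vec n j) $ i \<noteq> 0"
    using ij A by simp
  then have "A *\<^sub>v unit_vec n j \<noteq> 0\<^sub>v p" using ij by auto
  \<comment> \<open>If \<open>u\<close> has nonzero image, its own signs are forced on the support.
    Otherwise every \<open>y\<close> with entries in [-1, 1] is admissible, and a unit vector
    outside the kernel serves as \<open>z\<close>.\<close>
  then obtain z where z: "z \<in> carrier_vec n" "A *\<^sub>v z \<noteq> 0\<^sub>v p" "A *\<^sub>v u = 0\<^sub>v p \<or> z = u"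
    using u unit_vec_carrier by metis
  define y where "y = vec p (\<lambda>i. sgn ((A *\<^sub>v z) $ i))"
  have y: "y \<in> carrier_vec p" unfolding y_def by simp
  define s where "s = transpose_mat A *\<^sub>v y"
  have s: "s \<in> carrier_vec n" unfolding s_def using A y by simp
  have "s \<bullet> z = y \<bullet> (A *\<^sub>v z)"
    unfolding s_def by (rule transpose_vec_mult_scalar[OF A(1) z(1) y])
  also have "\<dots> = l1_norm (A *\<^sub>v z)"
    unfolding y_def scalar_prod_def l1_norm_def using A
    by (intro sum.cong) (auto simp: sgn_mult_self_eq abs_sgn mult.commute simp del: index_mult_mat_vec)
  also have "\<dots> \<noteq> 0" using z A by (subst l1_norm_eq_0_iff[of _ p]) auto
  finally have "s \<noteq> 0\<^sub>v n" using z(1) by auto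
  moreover have "s \<in> subdifferential n (analysis_l1 A) x"
    if x: "x \<in> carrier_vec n" "A *\<^sub>v x = A *\<^sub>v u" for x
    unfolding s_def
  proof (rule transpose_mult_in_subdifferential[OF A(1) x(1) y])
    fix i assume i: "i < p"
    show "\<bar>y $ i\<bar> \<le> 1" using i unfolding y_def by (simp add: abs_sgn_eq)
    show "y $ i * (A *\<^sub>v x) $ i = \<bar>(A *\<^sub>v x) $ i\<bar>"
      using z(3)
    proof
      assume "A *\<^sub>v u = 0\<^sub>v p"
      then show ?thesis using i x(2) by simp
    next
      assume "z = u"
      then have "y $ i = sgn ((A *\<^sub>v x) $ i)" unfolding y_def x(2) using i by simp
      then show ?thesis by (simp only: abs_sgn mult.commute)
    qed
  qed
  ultimately show ?thesis using s by blast
qed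

lemma error_estimate_kernel_line_tendsto_infinity:
  assumes A: "A \<in> carrier_mat p n" "A \<noteq> 0\<^sub>m p n" and u: "u \<in> carrier_vec n"
    and d: "d \<in> mat_kernel A" "d \<noteq> 0\<^sub>v n"
  shows "((\<lambda>t. error_estimate n (analysis_l1 A) (u + t \<cdot>\<^sub>v d)) \<longlongrightarrow> \<infinity>) at_top"
proof -
  note dc = mat_kernelD(1)[OF A(1) d(1)]
  obtain s where s: "s \<in> carrier_vec n" "s \<noteq> 0\<^sub>v n"
    "\<And>x. x \<in> carrier_vec n \<Longrightarrow> A *\<^sub>v x = A *\<^sub>v u \<Longrightarrow> s \<in> subdifferential n (analysis_l1 A) x"
    using exists_nonzero_subgradient[OF A u] by blast
  have c: "u + t \<cdot>\<^sub>v d \<in> carrier_vec n" for t using u dc by simp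
  show ?thesis
  proof (rule error_estimate_tendsto_infinity)
    show "0 < l2_norm s" by (rule l2_norm_pos[OF s(1,2)])
    show "\<forall>\<^sub>F t in at_top. \<exists>s'\<in>subdifferential n (analysis_l1 A) (u + t \<cdot>\<^sub>v d). l2_norm s \<le> l2_norm s'"
      using s(3)[OF c mult_kernel_line[OF A(1) u d(1)]] by (intro always_eventually) blast
    show "((\<lambda>t. l1_l2_ratio A (u + t \<cdot>\<^sub>v d)) \<longlongrightarrow> 0) at_top"
      by (rule l1_l2_ratio_kernel_line_tendsto_0[OF A(1) u d])
  qed (use A c in auto)
qed

text \<open>A trivial kernel would force \<open>n \<le> p\<close> and rank \<open>n\<close>. Square
  matrices count as fat, and an invertible one has a trivial kernel, so the square case carries a
  rank condition.\<close>

lemma nontrivial_kernel_if_rank_deficient: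
  fixes A :: "real mat"
  assumes A: "A \<in> carrier_mat p n"
    and "fat_mat A \<and> (p = n \<longrightarrow> vec_space.rank p A < n) \<or> tall_mat A \<and> vec_space.rank p A < n"
  shows "mat_kernel A \<noteq> {0\<^sub>v n}"
proof
  assume ker: "mat_kernel A = {0\<^sub>v n}"
  show False
    using assms(2) rank_eq_if_trivial_kernel[OF A ker] le_if_trivial_kernel[OF A ker] A
    unfolding fat_mat_def by auto
qed

lemma exists_nonzero_orth_proj_mat_kernel:
  assumes A: "A \<in> carrier_mat p n" and ker: "mat_kernel A \<noteq> {0\<^sub>v n}"
  shows "\<exists>c\<in>carrier_vec n. orth_proj (mat_kernel A) c \<noteq> 0\<^sub>v n"
proof -
  have "0\<^sub>v n \<in> mat_kernel A" using A by (intro mat_kernelI[OF A]) auto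
  then obtain c where c: "c \<in> mat_kernel A" "c \<noteq> 0\<^sub>v n" using ker by blast
  then show ?thesis
    using orth_proj_mat_kernel_id[OF A c(1)] mat_kernelD(1)[OF A c(1)] by auto
qed

text \<open>The signal is built from \<open>S\<close> before its support is known, so
  \<open>S\<close> ranges over all row sets: the support always lies inside \<open>S\<close>. If
  \<open>S\<close> is the support of the image of \<open>w\<close>, then projecting leaves
  \<open>w\<close> fixed and the support is exactly \<open>S\<close>.\<close>

lemma rank_deficient_signal:
  assumes A: "A \<in> carrier_mat p n" and S: "S \<subseteq> {..<p}"
    and w: "w \<in> carrier_vec n" and c: "c \<in> carrier_vec n"
    and nz: "orth_proj (mat_kernel A) c \<noteq> 0\<^sub>v n"
  shows "let u = orth_proj (mat_kernel (row_submatrix A ({..<p} - S))) w;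
             x = (\<lambda>t::real. u + orth_proj (mat_kernel A) (t \<cdot>\<^sub>v c))
         in l1_norm (A *\<^sub>v (u + orth_proj (mat_kernel A) c)) / l2_norm (u + orth_proj (mat_kernel A) c)
              = l1_norm (row_submatrix A S *\<^sub>v u) / l2_norm (u + orth_proj (mat_kernel A) c) \<and>
            vec_support (A *\<^sub>v (u + orth_proj (mat_kernel A) c)) \<subseteq> S \<and>
            (S = vec_support (A *\<^sub>v w) \<longrightarrow>
               vec_support (A *\<^sub>v (u + orth_proj (mat_kernel A) c)) = S) \<and>
            (\<exists>T\<ge>0. (u \<bullet> orth_proj (mat_kernel A) c \<ge> 0 \<longrightarrow> T = 0) \<and>
               (\<forall>s t. T \<le> s \<and> s < t \<longrightarrow>
                  l1_l2_ratio A (x t) \<le> l1_l2_ratio A (x s) \<and>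
                  (row_submatrix A S *\<^sub>v u \<noteq> 0\<^sub>v (card S) \<longrightarrow>
                     l1_l2_ratio A (x t) < l1_l2_ratio A (x s)))) \<and>
            ((\<lambda>t. l1_l2_ratio A (x t)) \<longlongrightarrow> 0) at_top \<and>
            (A \<noteq> 0\<^sub>m p n \<longrightarrow>
               ((\<lambda>t. error_estimate n (analysis_l1 A) (x t)) \<longlongrightarrow> \<infinity>) at_top)"
proof -
  define B where "B = row_submatrix A ({..<p} - S)"
  define u where "u = orth_proj (mat_kernel B) w"
  define d where "d = orth_proj (mat_kernel A) c"
  have B: "B \<in> carrier_mat (card ({..<p} - S)) n"
    unfolding B_def by (rule row_submatrix_carrier[OF A]) auto
  have ker_B: "v \<in> mat_kernel B \<longleftrightarrow> v \<in> carrier_vec n \<and> (\<forall>i\<in>{..<p} - S. (A *\<^sub>v v) $ i = 0)" for v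
    unfolding B_def by (rule mat_kernel_row_submatrix_iff[OF A]) auto
  have "u \<in> mat_kernel B" unfolding u_def by (rule orth_proj_in_mat_kernel[OF B w])
  then have u: "u \<in> carrier_vec n" and u0: "\<And>i. i < p \<Longrightarrow> i \<notin> S \<Longrightarrow> (A *\<^sub>v u) $ i = 0"
    unfolding ker_B by blast+
  have d: "d \<in> mat_kernel A" "d \<noteq> 0\<^sub>v n"
    unfolding d_def by (rule orth_proj_in_mat_kernel[OF A c]) (rule nz)
  have line: "orth_proj (mat_kernel A) (t \<cdot>\<^sub>v c) = t \<cdot>\<^sub>v d" for t
    unfolding d_def by (rule orth_proj_mat_kernel_smult[OF A c])
  have Aud: "A *\<^sub>v (u + d) = A *\<^sub>v u"
    using mult_kernel_line[OF A u d(1), of 1] by simp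
  \<comment> \<open>The rows outside \<open>S\<close> annihilate \<open>u\<close>, so they
    contribute nothing to the sum.\<close>
  have l1: "l1_norm (A *\<^sub>v u) = l1_norm (row_submatrix A S *\<^sub>v u)"
    unfolding l1_norm_row_submatrix[OF A S u] unfolding l1_norm_def
    using A S u0 by (intro sum.mono_neutral_right) (auto simp del: index_mult_mat_vec)
  have supp: "vec_support (A *\<^sub>v u) \<subseteq> S"
    unfolding vec_support_def using A u0 by (auto simp del: index_mult_mat_vec)
  have supp_eq: "vec_support (A *\<^sub>v u) = S" if "S = vec_support (A *\<^sub>v w)"
  proof -
    have "w \<in> mat_kernel B"
      unfolding ker_B using that w A unfolding vec_support_def by (auto simp del: index_mult_mat_vec)
    then have "u = w" unfolding u_def by (rule orth_proj_mat_kernel_id[OF B])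
    then show ?thesis using that by simp
  qed
  have nz_iff: "A *\<^sub>v u \<noteq> 0\<^sub>v p" if "row_submatrix A S *\<^sub>v u \<noteq> 0\<^sub>v (card S)"
    using that l1 l1_norm_eq_0_iff[of "A *\<^sub>v u" p] A u
      l1_norm_eq_0_iff[of "row_submatrix A S *\<^sub>v u" "card S"] row_submatrix_carrier[OF A S]
    by auto
  \<comment> \<open>The vertex of the parabola, cut off at 0. For negative
    \<open>u \<bullet> d\<close> the norm first shrinks as the multiplier grows from 0, so the ratio
    need not decrease before this point.\<close>
  define T where "T = max 0 (- (u \<bullet> d) / (d \<bullet> d))"
  have "T = 0" if "0 \<le> u \<bullet> d"
    unfolding T_def using that scalar_prod_self_nonneg[of d] by (simp add: divide_nonpos_nonneg)
  moreover have "0 \<le> T" and T: "- (u \<bullet> d) / (d \<bullet> d) \<le> T" unfolding T_def by auto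
  moreover have "l1_l2_ratio A (u + t \<cdot>\<^sub>v d) \<le> l1_l2_ratio A (u + s \<cdot>\<^sub>v d)"
    "row_submatrix A S *\<^sub>v u \<noteq> 0\<^sub>v (card S) \<Longrightarrow>
      l1_l2_ratio A (u + t \<cdot>\<^sub>v d) < l1_l2_ratio A (u + s \<cdot>\<^sub>v d)" if "T \<le> s" "s < t" for s t
    using l1_l2_ratio_kernel_line_mono[OF A u d order_trans[OF T that(1)] that(2)] nz_iff
    by blast+
  ultimately have "\<exists>T\<ge>0. (u \<bullet> d \<ge> 0 \<longrightarrow> T = 0) \<and>
      (\<forall>s t. T \<le> s \<and> s < t \<longrightarrow>
         l1_l2_ratio A (u + t \<cdot>\<^sub>v d) \<le> l1_l2_ratio A (u + s \<cdot>\<^sub>v d) \<and>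
         (row_submatrix A S *\<^sub>v u \<noteq> 0\<^sub>v (card S) \<longrightarrow>
            l1_l2_ratio A (u + t \<cdot>\<^sub>v d) < l1_l2_ratio A (u + s \<cdot>\<^sub>v d)))"
    by blast
  then show ?thesis
    unfolding Let_def B_def[symmetric] u_def[symmetric] line d_def[symmetric] Aud l1
    using supp supp_eq l1_l2_ratio_kernel_line_tendsto_0[OF A u d]
      error_estimate_kernel_line_tendsto_infinity[OF A _ u d]
    by blast
qed

subsection \<open>The stacked operator\<close>

lemma col_scalar_prod_col:
  assumes U: "U \<in> carrier_mat m n" and on: "orthonormal_cols U" and "i < n" "j < n"
  shows "col U i \<bullet> col U j = (if i = j then 1 else 0)"
proof -
  have "col U i \<bullet> col U j = (transpose_mat U * U) $$ (i, j)" using assms by simp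
  also have "\<dots> = 1\<^sub>m n $$ (i, j)" using on U unfolding orthonormal_cols_def by simp
  finally show ?thesis using assms by simp
qed

lemma mult_unit_vec_eq_col:
  fixes A :: "real mat"
  assumes "A \<in> carrier_mat p n" "j < n"
  shows "A *\<^sub>v unit_vec n j = col A j"
  using assms by (intro eq_vecI) auto

lemma transpose_mult_col:
  assumes U: "U \<in> carrier_mat m n" and on: "orthonormal_cols U" and j: "j < n"
  shows "transpose_mat U *\<^sub>v col U j = unit_vec n j"
  using U j col_scalar_prod_col[OF U on _ j] by (intro eq_vecI) auto

locale stacked_operator =
  fixes m k n :: nat and U V :: "real mat"
  assumes n_less_m: "n < m" and k_less_n: "k < n"
    and incomplete_unitary_U: "incomplete_unitary m n U"
    and complete_unitary_V: "complete_unitary n V"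
begin

lemma U: "U \<in> carrier_mat m n" "orthonormal_cols U"
  using incomplete_unitary_U unfolding incomplete_unitary_def by auto

lemma V: "V \<in> carrier_mat n n" "orthonormal_cols V"
  using complete_unitary_V unfolding complete_unitary_def by auto

declare One_nat_def [simp del]

lemma col_carrier: "col U j \<in> carrier_vec m" "col V j \<in> carrier_vec n"
  using U V by (metis carrier_matD(1) col_dim)+

abbreviation "scaling \<sigma> \<equiv> mat_diag n (\<lambda>i. if i = n - 1 then \<sigma> else 1 :: real)"

lemma block_A_carrier: "block_A n U V \<sigma> \<in> carrier_mat m n"
  using U V mat_diag_dim unfolding block_A_def by (metis mult_carrier_mat transpose_carrier_mat)

lemma block_A_mult:
  assumes z: "z \<in> carrier_vec n"
  shows "block_A n U V \<sigma> *\<^sub>v z = U *\<^sub>v (scaling \<sigma> *\<^sub>v (transpose_mat V *\<^sub>v z))"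
proof -
  have V': "transpose_mat V \<in> carrier_mat n n" using V by simp
  have "U * scaling \<sigma> \<in> carrier_mat m n" by (rule mult_carrier_mat[OF U(1) mat_diag_dim])
  then have "block_A n U V \<sigma> *\<^sub>v z = (U * scaling \<sigma>) *\<^sub>v (transpose_mat V *\<^sub>v z)"
    unfolding block_A_def by (rule assoc_mult_mat_vec[OF _ V' z])
  also have "\<dots> = U *\<^sub>v (scaling \<sigma> *\<^sub>v (transpose_mat V *\<^sub>v z))"
    by (rule assoc_mult_mat_vec[OF U(1) mat_diag_dim]) (use V' z in simp)
  finally show ?thesis .
qed

lemma block_B_carrier: "block_B n k V \<in> carrier_mat k n"
  unfolding block_B_def by (rule mat_of_rows_carrier(1)[of n "map (col V) [0..<k]", simplified])

lemma stacked_op_carrier: "stacked_op n k U V \<sigma> \<in> carrier_mat (m + k) n"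
  unfolding stacked_op_def by (rule carrier_append_rows[OF block_A_carrier block_B_carrier])

lemma stacked_op_mult:
  "z \<in> carrier_vec n \<Longrightarrow>
    stacked_op n k U V \<sigma> *\<^sub>v z = (block_A n U V \<sigma> *\<^sub>v z) @\<^sub>v (block_B n k V *\<^sub>v z)"
  unfolding stacked_op_def by (rule mat_mult_append[OF block_A_carrier block_B_carrier])

lemma scaling_mult_unit_vec:
  "j < n \<Longrightarrow> scaling \<sigma> *\<^sub>v unit_vec n j = (if j = n - 1 then \<sigma> else 1) \<cdot>\<^sub>v unit_vec n j"
  by (subst mult_unit_vec_eq_col[OF mat_diag_dim]) (auto simp: mat_diag_def)

text \<open>The product defining the block is a singular value decomposition: the transpose of
  \<open>V\<close> sends its column to a unit vector, which is scaled and then mapped to a column of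
  \<open>U\<close>.\<close>

lemma block_A_mult_col:
  assumes j: "j < n"
  shows "block_A n U V \<sigma> *\<^sub>v col V j = (if j = n - 1 then \<sigma> else 1) \<cdot>\<^sub>v col U j"
  by (simp only: block_A_mult[OF col_carrier(2)] transpose_mult_col[OF V j]
      scaling_mult_unit_vec[OF j] mult_mat_vec[OF U(1) unit_vec_carrier]
      mult_unit_vec_eq_col[OF U(1) j])

text \<open>By orthonormality the result is a unit vector for \<open>j < k\<close> and zero for
  \<open>j \<ge> k\<close>; the last column falls under the second case because
  \<open>k \<le> n - 1\<close>.\<close>

lemma block_B_mult_col:
  assumes j: "j < n"
  shows "block_B n k V *\<^sub>v col V j = vec k (\<lambda>i. if i = j then 1 else 0)"
proof (rule eq_vecI)
  fix i assume "i < dim_vec (vec k (\<lambda>i. if i = j then 1 else 0 :: real))"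
  then have i: "i < k" by simp
  then have "row (block_B n k V) i = col V i"
    unfolding block_B_def using V by (subst mat_of_rows_row) auto
  then show "(block_B n k V *\<^sub>v col V j) $ i = vec k (\<lambda>i. if i = j then 1 else 0) $ i"
    using i j k_less_n block_B_carrier col_scalar_prod_col[OF V] by simp
qed (use block_B_carrier in simp)

lemma last_less: "n - 1 < n" "k \<le> n - 1"
  using k_less_n by auto

lemma last_col_V: "col V (n - 1) \<in> carrier_vec n" "l2_norm (col V (n - 1)) = 1"
  unfolding l2_norm_def using col_carrier col_scalar_prod_col[OF V] last_less by auto

lemma stacked_op_mult_last:
  "stacked_op n k U V \<sigma> *\<^sub>v col V (n - 1) = (\<sigma> \<cdot>\<^sub>v col U (n - 1)) @\<^sub>v 0\<^sub>v k"
proof -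
  have "vec k (\<lambda>i. if i = n - 1 then 1 else 0 :: real) = 0\<^sub>v k"
    using last_less by (intro eq_vecI) auto
  then show ?thesis
    using last_less by (simp add: stacked_op_mult last_col_V block_A_mult_col block_B_mult_col)
qed

lemma stacked_op_mult_last_index:
  "i < m \<Longrightarrow> (stacked_op n k U V \<sigma> *\<^sub>v col V (n - 1)) $ i = \<sigma> * col U (n - 1) $ i"
  "m \<le> i \<Longrightarrow> i < m + k \<Longrightarrow> (stacked_op n k U V \<sigma> *\<^sub>v col V (n - 1)) $ i = 0"
  unfolding stacked_op_mult_last using U by auto

lemma stacked_op_l1_l2_ratio:
  assumes "0 < \<sigma>"
  shows "l1_l2_ratio (stacked_op n k U V \<sigma>) (col V (n - 1)) = \<sigma> * l1_norm (col U (n - 1))"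
proof -
  have "l1_norm (stacked_op n k U V \<sigma> *\<^sub>v col V (n - 1)) =
      (\<Sum>i<m. \<bar>(stacked_op n k U V \<sigma> *\<^sub>v col V (n - 1)) $ i\<bar>)"
    unfolding l1_norm_def using stacked_op_carrier[of \<sigma>] stacked_op_mult_last_index
    by (intro sum.mono_neutral_right) (auto simp del: index_mult_mat_vec)
  also have "\<dots> = \<sigma> * l1_norm (col U (n - 1))"
    unfolding l1_norm_def sum_distrib_left using U assms
    by (intro sum.cong) (auto simp: stacked_op_mult_last_index abs_mult simp del: index_mult_mat_vec)
  finally show ?thesis unfolding l1_l2_ratio_def last_col_V(2) by simp
qed

lemma stacked_op_ratio_tendsto_0:
  "((\<lambda>\<sigma>. l1_l2_ratio (stacked_op n k U V \<sigma>) (col V (n - 1))) \<longlongrightarrow> 0) (at_right 0)"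
proof -
  have "((\<lambda>\<sigma>. \<sigma> * l1_norm (col U (n - 1))) \<longlongrightarrow> 0 * l1_norm (col U (n - 1))) (at_right 0)"
    by (intro tendsto_intros)
  moreover have "\<forall>\<^sub>F \<sigma> in at_right 0. \<sigma> * l1_norm (col U (n - 1)) =
      l1_l2_ratio (stacked_op n k U V \<sigma>) (col V (n - 1))"
    using eventually_at_right_less[of "0 :: real"] by eventually_elim (simp add: stacked_op_l1_l2_ratio)
  ultimately show ?thesis by (simp add: tendsto_cong)
qed

text \<open>The upper block is already injective: orthonormal columns cancel \<open>U\<close>, the
  diagonal has no zero entry since \<sigma> is positive, and \<open>V\<close> is invertible.\<close>

lemma mat_kernel_stacked_op:
  assumes "0 < \<sigma>"
  shows "mat_kernel (stacked_op n k U V \<sigma>) = {0\<^sub>v n}"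
proof
  have "stacked_op n k U V \<sigma> *\<^sub>v 0\<^sub>v n = 0\<^sub>v (m + k)"
    using stacked_op_carrier[of \<sigma>] by (intro eq_vecI) simp_all
  then show "{0\<^sub>v n} \<subseteq> mat_kernel (stacked_op n k U V \<sigma>)"
    using mat_kernelI[OF stacked_op_carrier zero_carrier_vec] by simp
next
  show "mat_kernel (stacked_op n k U V \<sigma>) \<subseteq> {0\<^sub>v n}"
  proof
    fix z assume "z \<in> mat_kernel (stacked_op n k U V \<sigma>)"
    note z = mat_kernelD[OF stacked_op_carrier this]
    define v where "v = transpose_mat V *\<^sub>v z"
    have v: "v \<in> carrier_vec n" unfolding v_def using V z by simp
    have Dv: "scaling \<sigma> *\<^sub>v v \<in> carrier_vec n" by (rule mult_mat_vec_carrier[OF mat_diag_dim v])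
    have "block_A n U V \<sigma> *\<^sub>v z = 0\<^sub>v m"
    proof (rule eq_vecI)
      fix i assume "i < dim_vec (0\<^sub>v m :: real vec)"
      then have i: "i < m" by simp
      then have "(block_A n U V \<sigma> *\<^sub>v z) $ i = (stacked_op n k U V \<sigma> *\<^sub>v z) $ i"
        unfolding stacked_op_mult[OF z(1)] using block_A_carrier[of \<sigma>] by simp
      then show "(block_A n U V \<sigma> *\<^sub>v z) $ i = 0\<^sub>v m $ i"
        unfolding z(2) using i by simp
    qed (use block_A_carrier[of \<sigma>] in simp)
    then have "transpose_mat U *\<^sub>v (U *\<^sub>v (scaling \<sigma> *\<^sub>v v)) = transpose_mat U *\<^sub>v 0\<^sub>v m"
      using block_A_mult[OF z(1), of \<sigma>] unfolding v_def by simp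
    also have "transpose_mat U *\<^sub>v (U *\<^sub>v (scaling \<sigma> *\<^sub>v v)) = (transpose_mat U * U) *\<^sub>v (scaling \<sigma> *\<^sub>v v)"
      by (rule assoc_mult_mat_vec[symmetric, OF _ U(1) Dv]) (use U in simp)
    also have "\<dots> = scaling \<sigma> *\<^sub>v v"
      using U Dv unfolding orthonormal_cols_def by simp
    also have "transpose_mat U *\<^sub>v 0\<^sub>v m = 0\<^sub>v n"
      using U by (intro eq_vecI) auto
    finally have Dv0: "scaling \<sigma> *\<^sub>v v = 0\<^sub>v n" .
    have "v = 0\<^sub>v n"
    proof (rule eq_vecI)
      fix i assume "i < dim_vec (0\<^sub>v n :: real vec)"
      then have i: "i < n" by simp
      have "row (scaling \<sigma>) i = (if i = n - 1 then \<sigma> else 1) \<cdot>\<^sub>v unit_vec n i"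
        using i by (intro eq_vecI) (auto simp: mat_diag_def)
      then have "(scaling \<sigma> *\<^sub>v v) $ i = (if i = n - 1 then \<sigma> else 1) * v $ i"
        using i v by (subst index_mult_mat_vec) (simp_all add: mat_diag_def)
      then show "v $ i = 0\<^sub>v n $ i"
        unfolding Dv0 using i assms by (simp split: if_splits)
    qed (use v in simp)
    \<comment> \<open>Orthonormal columns give the product in the other order; for a square matrix a
      one-sided inverse is two-sided.\<close>
    have "V * transpose_mat V = 1\<^sub>m n"
      using V unfolding orthonormal_cols_def
      by (intro mat_mult_left_right_inverse[of "transpose_mat V" n V]) simp_all
    then have "z = (V * transpose_mat V) *\<^sub>v z" using z(1) by simp
    also have "\<dots> = V *\<^sub>v v"
      unfolding v_def by (rule assoc_mult_mat_vec[OF V(1) _ z(1)]) (use V in simp)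
    also have "\<dots> = 0\<^sub>v n"
      unfolding \<open>v = 0\<^sub>v n\<close> using V by (intro eq_vecI) auto
    finally show "z \<in> {0\<^sub>v n}" by simp
  qed
qed

text \<open>The zero entries of \<open>\<Omega> x\<close> leave the coefficient of the first row \<open>v\<^sub>1\<close> of \<open>B\<close> free in
  \<open>[-1, 1]\<close>, so it can be given the sign of the remaining contribution in the direction \<open>v\<^sub>1\<close>.\<close>

lemma exists_subgradient_norm_ge_1:
  assumes \<sigma>: "0 < \<sigma>" and k: "0 < k"
  shows "\<exists>s\<in>subdifferential n (analysis_l1 (stacked_op n k U V \<sigma>)) (col V (n - 1)). 1 \<le> l2_norm s"
proof -
  define \<Omega> where "\<Omega> = stacked_op n k U V \<sigma>"
  define y1 where "y1 = vec m (\<lambda>i. sgn (col U (n - 1) $ i))"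
  define \<alpha> where "\<alpha> = y1 \<bullet> col U 0"
  \<comment> \<open>With this sign the absolute value of \<open>\<alpha> + \<zeta>\<close> is that
    of \<alpha> plus 1.\<close>
  define \<zeta> :: real where "\<zeta> = (if 0 \<le> \<alpha> then 1 else - 1)"
  define y where "y = y1 @\<^sub>v (\<zeta> \<cdot>\<^sub>v unit_vec k 0)"
  define s where "s = transpose_mat \<Omega> *\<^sub>v y"
  have \<Omega>: "\<Omega> \<in> carrier_mat (m + k) n" unfolding \<Omega>_def by (rule stacked_op_carrier)
  have y1: "y1 \<in> carrier_vec m" unfolding y1_def by simp
  have y: "y \<in> carrier_vec (m + k)" unfolding y_def using y1 by auto
  have y_low: "y $ i = sgn (col U (n - 1) $ i)" if "i < m" for i
    using that y1 unfolding y_def y1_def by simp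
  have y_high: "\<bar>y $ i\<bar> \<le> 1" if "m \<le> i" "i < m + k" for i
    using that y1 k unfolding y_def \<zeta>_def by (auto simp: unit_vec_def)
  have "s \<in> subdifferential n (analysis_l1 \<Omega>) (col V (n - 1))"
    unfolding s_def
  proof (rule transpose_mult_in_subdifferential[OF \<Omega> last_col_V(1) y])
    fix i assume i: "i < m + k"
    show "\<bar>y $ i\<bar> \<le> 1"
      using y_low[of i] y_high[of i] i by (cases "i < m") (auto simp: abs_sgn_eq)
    show "y $ i * (\<Omega> *\<^sub>v col V (n - 1)) $ i = \<bar>(\<Omega> *\<^sub>v col V (n - 1)) $ i\<bar>"
    proof (cases "i < m")
      case True
      have "sgn a * (\<sigma> * a) = \<bar>\<sigma> * a\<bar>" for a :: real
        using \<sigma> by (simp add: abs_mult abs_sgn sgn_mult)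
      then show ?thesis unfolding \<Omega>_def stacked_op_mult_last_index(1)[OF True] y_low[OF True] .
    next
      case False
      then show ?thesis using i unfolding \<Omega>_def by (simp add: stacked_op_mult_last_index(2) del: index_mult_mat_vec)
    qed
  qed
  moreover have "1 \<le> l2_norm s"
  proof -
    have V0: "col V 0 \<in> carrier_vec n" by (rule col_carrier)
    \<comment> \<open>From \<open>0 < k < n\<close> the first column differs from the last, so it is
      scaled by 1 and not by \<sigma>; this makes the bound independent of \<sigma>.\<close>
    have j: "0 < n" "0 \<noteq> n - 1" using k k_less_n by auto
    have unit: "vec k (\<lambda>i. if i = 0 then 1 else 0 :: real) = unit_vec k 0"
      by (auto simp: unit_vec_def)
    have "s \<bullet> col V 0 = y \<bullet> (\<Omega> *\<^sub>v col V 0)"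
      unfolding s_def by (rule transpose_vec_mult_scalar[OF \<Omega> V0 y])
    also have "\<Omega> *\<^sub>v col V 0 = col U 0 @\<^sub>v unit_vec k 0"
      unfolding \<Omega>_def stacked_op_mult[OF V0] block_A_mult_col[OF j(1)] block_B_mult_col[OF j(1)] unit
      using j by simp
    also have "y \<bullet> (col U 0 @\<^sub>v unit_vec k 0) = \<alpha> + (\<zeta> \<cdot>\<^sub>v unit_vec k 0) \<bullet> unit_vec k 0"
      unfolding y_def \<alpha>_def using y1 U by (intro scalar_prod_append[of _ m _ k]) auto
    also have "(\<zeta> \<cdot>\<^sub>v unit_vec k 0) \<bullet> unit_vec k 0 = \<zeta>" using k by simp
    finally have "1 \<le> \<bar>s \<bullet> col V 0\<bar>" unfolding \<zeta>_def by auto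
    also have "\<dots> \<le> l2_norm s"
      using \<Omega> y V0 col_scalar_prod_col[OF V j(1) j(1)] unfolding s_def
      by (intro abs_scalar_prod_unit_le[of _ n]) auto
    finally show ?thesis .
  qed
  ultimately show ?thesis unfolding \<Omega>_def by blast
qed

lemma stacked_op_error_estimate_tendsto_infinity:
  assumes "0 < k"
  shows "((\<lambda>\<sigma>. error_estimate n (analysis_l1 (stacked_op n k U V \<sigma>)) (col V (n - 1))) \<longlongrightarrow> \<infinity>)
    (at_right 0)"
proof (rule error_estimate_tendsto_infinity[OF stacked_op_carrier last_col_V(1)])
  show "\<forall>\<^sub>F \<sigma> in at_right 0.
      \<exists>s\<in>subdifferential n (analysis_l1 (stacked_op n k U V \<sigma>)) (col V (n - 1)). 1 \<le> l2_norm s"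
    using eventually_at_right_less[of "0 :: real"]
    by eventually_elim (rule exists_subgradient_norm_ge_1[OF _ assms])
qed (simp_all add: stacked_op_ratio_tendsto_0)

lemma last_col_V_nonzero: "col V (n - 1) \<noteq> 0\<^sub>v n"
  using last_col_V(2) unfolding l2_norm_def by auto

lemma last_col_V_in_mat_kernel:
  "col V (n - 1) \<in> mat_kernel (row_submatrix (stacked_op n k U V \<sigma>) {m..<m + k})"
  using last_col_V(1) stacked_op_mult_last_index(2)
  by (subst mat_kernel_row_submatrix_iff[OF stacked_op_carrier]) auto

text \<open>The upper entries of the image are those of the last column of \<open>U\<close> times
  \<sigma>, so they fill \<open>{..<m}\<close> only if that column has no zero entry.\<close>

lemma vec_support_stacked_op:
  "vec_support (stacked_op n k U V \<sigma> *\<^sub>v col V (n - 1)) \<subseteq> {..<m}"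
  "0 < \<sigma> \<Longrightarrow> \<forall>i<m. col U (n - 1) $ i \<noteq> 0 \<Longrightarrow>
    vec_support (stacked_op n k U V \<sigma> *\<^sub>v col V (n - 1)) = {..<m}"
proof -
  show sub: "vec_support (stacked_op n k U V \<sigma> *\<^sub>v col V (n - 1)) \<subseteq> {..<m}"
    using stacked_op_mult_last_index(2)[of _ \<sigma>] stacked_op_carrier[of \<sigma>]
    unfolding vec_support_def by (auto simp del: index_mult_mat_vec intro: leI)
  show "vec_support (stacked_op n k U V \<sigma> *\<^sub>v col V (n - 1)) = {..<m}"
    if "0 < \<sigma>" "\<forall>i<m. col U (n - 1) $ i \<noteq> 0"
    using sub that stacked_op_mult_last_index(1)[of _ \<sigma>] stacked_op_carrier[of \<sigma>]
    unfolding vec_support_def by (auto simp del: index_mult_mat_vec)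
qed

lemma rank_stacked_op: "0 < \<sigma> \<Longrightarrow> vec_space.rank (m + k) (stacked_op n k U V \<sigma>) = n"
  by (rule rank_eq_if_trivial_kernel[OF stacked_op_carrier mat_kernel_stacked_op])

lemma tall_stacked_op: "tall_mat (stacked_op n k U V \<sigma>)"
  using stacked_op_carrier[of \<sigma>] n_less_m unfolding tall_mat_def by auto

end

text \<open>The construction with an empty lower block reaches every \<open>p > n\<close>; the first
  \<open>n\<close> unit vectors serve as columns of \<open>U\<close>, and \<open>V\<close> is the
  identity.\<close>

lemma exists_full_rank_tall_small_ratio:
  assumes "0 < \<epsilon>" "0 < n" "n < p"
  shows "\<exists>\<Omega>\<in>carrier_mat p n. \<exists>x\<in>carrier_vec n.
    tall_mat \<Omega> \<and> vec_space.rank p \<Omega> = n \<and> x \<noteq> 0\<^sub>v n \<and> l1_l2_ratio \<Omega> x < \<epsilon>"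
proof -
  define U where "U = mat p n (\<lambda>(i, j). if i = j then 1 else 0 :: real)"
  have col: "col U i \<bullet> col U j = (if i = j then 1 else 0)" if "i < n" "j < n" for i j
  proof -
    have "col U i \<bullet> col U j = (\<Sum>l<p. if l = i then (if i = j then 1 else 0) else 0)"
      using that unfolding U_def scalar_prod_def atLeast0LessThan by (intro sum.cong) auto
    then show ?thesis using that assms by simp
  qed
  have "transpose_mat U * U = 1\<^sub>m n"
    using col by (intro eq_matI) (auto simp: U_def)
  then have "incomplete_unitary p n U"
    unfolding incomplete_unitary_def orthonormal_cols_def using assms by (auto simp: U_def)
  moreover have "complete_unitary n (1\<^sub>m n)"
    unfolding complete_unitary_def orthonormal_cols_def by simp
  ultimately interpret stacked_operator p 0 n U "1\<^sub>m n"
    using assms by unfold_locales auto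
  \<comment> \<open>The added 1 keeps the denominator positive and makes the final inequality
    strict.\<close>
  define \<sigma> where "\<sigma> = \<epsilon> / (l1_norm (col U (n - 1)) + 1)"
  have pos: "0 < l1_norm (col U (n - 1)) + 1" using l1_norm_nonneg by (simp add: add_nonneg_pos)
  have \<sigma>: "0 < \<sigma>" unfolding \<sigma>_def using assms(1) pos by simp
  have "\<sigma> * l1_norm (col U (n - 1)) < \<epsilon>"
    unfolding \<sigma>_def using assms(1) pos by (simp add: field_simps)
  then show ?thesis
    using stacked_op_carrier[of \<sigma>] last_col_V(1) tall_stacked_op[of \<sigma>] rank_stacked_op[OF \<sigma>]
      last_col_V_nonzero stacked_op_l1_l2_ratio[OF \<sigma>]
    by (intro bexI[of _ "stacked_op n 0 U (1\<^sub>m n) \<sigma>"] bexI[of _ "col (1\<^sub>m n) (n - 1)"]) simp_all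
qed

text \<open>The limits to \<infinity> need a numerator that does not vanish with the ratio. For a
  zero operator the only subgradient is 0 and the estimate is constantly 0 in \<open>ereal\<close>.
  For \<open>k = 0\<close> and \<open>n = 1\<close> the supremum shrinks with \<sigma> at the same
  rate as the ratio, and the estimate stays at 2.\<close>

theorem mainTheorem2:
  shows
   "(\<forall>p n \<Omega> x. \<Omega> \<in> carrier_mat p n \<and> x \<in> carrier_vec n \<and> x \<noteq> 0\<^sub>v n \<longrightarrow>
       analysis_l1 \<Omega> ((1 / l2_norm x) \<cdot>\<^sub>v x) = l1_l2_ratio \<Omega> x)
  \<and> (\<forall>p n \<Omega>. \<Omega> \<in> carrier_mat p n \<and>
       (fat_mat \<Omega> \<and> (p = n \<longrightarrow> vec_space.rank p \<Omega> < n) \<or>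
        tall_mat \<Omega> \<and> vec_space.rank p \<Omega> < n) \<longrightarrow>
       mat_kernel \<Omega> \<noteq> {0\<^sub>v n} \<and>
       (\<exists>c\<in>carrier_vec n. orth_proj (mat_kernel \<Omega>) c \<noteq> 0\<^sub>v n) \<and>
       (\<forall>S w c. S \<subseteq> {..<p} \<and> w \<in> carrier_vec n \<and> c \<in> carrier_vec n \<and>
          orth_proj (mat_kernel \<Omega>) c \<noteq> 0\<^sub>v n \<longrightarrow>
          (let u = orth_proj (mat_kernel (row_submatrix \<Omega> ({..<p} - S))) w;
               x = (\<lambda>t::real. u + orth_proj (mat_kernel \<Omega>) (t \<cdot>\<^sub>v c))
           in l1_norm (\<Omega> *\<^sub>v (u + orth_proj (mat_kernel \<Omega>) c))
                  / l2_norm (u + orth_proj (mat_kernel \<Omega>) c)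
                = l1_norm (row_submatrix \<Omega> S *\<^sub>v u)
                  / l2_norm (u + orth_proj (mat_kernel \<Omega>) c) \<and>
              vec_support (\<Omega> *\<^sub>v (u + orth_proj (mat_kernel \<Omega>) c)) \<subseteq> S \<and>
              (S = vec_support (\<Omega> *\<^sub>v w) \<longrightarrow>
                 vec_support (\<Omega> *\<^sub>v (u + orth_proj (mat_kernel \<Omega>) c)) = S) \<and>
              (\<exists>T\<ge>0. (u \<bullet> orth_proj (mat_kernel \<Omega>) c \<ge> 0 \<longrightarrow> T = 0) \<and>
                 (\<forall>s t. T \<le> s \<and> s < t \<longrightarrow>
                    l1_l2_ratio \<Omega> (x t) \<le> l1_l2_ratio \<Omega> (x s) \<and>
                    (row_submatrix \<Omega> S *\<^sub>v u \<noteq> 0\<^sub>v (card S) \<longrightarrow>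
                       l1_l2_ratio \<Omega> (x t) < l1_l2_ratio \<Omega> (x s)))) \<and>
              ((\<lambda>t. l1_l2_ratio \<Omega> (x t)) \<longlongrightarrow> 0) at_top \<and>
              (\<Omega> \<noteq> 0\<^sub>m p n \<longrightarrow>
                 ((\<lambda>t. error_estimate n (analysis_l1 \<Omega>) (x t)) \<longlongrightarrow> \<infinity>) at_top))))
  \<and> (\<forall>p n. \<forall>\<epsilon>>0. 0 < n \<and> n < p \<longrightarrow>
       (\<exists>\<Omega>\<in>carrier_mat p n. \<exists>x\<in>carrier_vec n.
          tall_mat \<Omega> \<and> vec_space.rank p \<Omega> = n \<and> x \<noteq> 0\<^sub>v n \<and> l1_l2_ratio \<Omega> x < \<epsilon>))
  \<and> (\<forall>m k n U V. n < m \<and> k < n \<and> incomplete_unitary m n U \<and> complete_unitary n V \<longrightarrow>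
       (let \<Omega> = stacked_op n k U V; x = col V (n - 1); u = col U (n - 1)
        in (\<forall>\<sigma>>0. \<Omega> \<sigma> \<in> carrier_mat (m + k) n \<and> tall_mat (\<Omega> \<sigma>) \<and>
              vec_space.rank (m + k) (\<Omega> \<sigma>) = n \<and>
              x \<in> mat_kernel (row_submatrix (\<Omega> \<sigma>) {m..<m + k}) \<and> x \<noteq> 0\<^sub>v n \<and>
              vec_support (\<Omega> \<sigma> *\<^sub>v x) \<subseteq> {..<m} \<and>
              ((\<forall>i<m. u $ i \<noteq> 0) \<longrightarrow> vec_support (\<Omega> \<sigma> *\<^sub>v x) = {..<m}) \<and>
              l1_norm (\<Omega> \<sigma> *\<^sub>v x) / l2_norm x = \<sigma> * l1_norm u) \<and>
           ((\<lambda>\<sigma>. l1_l2_ratio (\<Omega> \<sigma>) x) \<longlongrightarrow> 0) (at_right 0) \<and>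
           (0 < k \<longrightarrow>
              ((\<lambda>\<sigma>. error_estimate n (analysis_l1 (\<Omega> \<sigma>)) x) \<longlongrightarrow> \<infinity>) (at_right 0))))"
proof (intro conjI allI impI; (elim conjE)?)
  fix p n :: nat and \<Omega> :: "real mat" and x :: "real vec" assume "\<Omega> \<in> carrier_mat p n" "x \<in> carrier_vec n"
  then show "analysis_l1 \<Omega> ((1 / l2_norm x) \<cdot>\<^sub>v x) = l1_l2_ratio \<Omega> x"
    by (rule analysis_l1_normalized)
next
  fix p n :: nat and \<Omega> :: "real mat"
  assume A: "\<Omega> \<in> carrier_mat p n"
    and "fat_mat \<Omega> \<and> (p = n \<longrightarrow> vec_space.rank p \<Omega> < n) \<or> tall_mat \<Omega> \<and> vec_space.rank p \<Omega> < n"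
  then show ker: "mat_kernel \<Omega> \<noteq> {0\<^sub>v n}" by (rule nontrivial_kernel_if_rank_deficient)
  then show "\<exists>c\<in>carrier_vec n. orth_proj (mat_kernel \<Omega>) c \<noteq> 0\<^sub>v n"
    by (rule exists_nonzero_orth_proj_mat_kernel[OF A])
next
  fix p n :: nat and \<Omega> :: "real mat" and S and w c :: "real vec"
  assume "\<Omega> \<in> carrier_mat p n" "S \<subseteq> {..<p}" "w \<in> carrier_vec n" "c \<in> carrier_vec n"
    "orth_proj (mat_kernel \<Omega>) c \<noteq> 0\<^sub>v n"
  then show "let u = orth_proj (mat_kernel (row_submatrix \<Omega> ({..<p} - S))) w;
               x = (\<lambda>t::real. u + orth_proj (mat_kernel \<Omega>) (t \<cdot>\<^sub>v c))
           in l1_norm (\<Omega> *\<^sub>v (u + orth_proj (mat_kernel \<Omega>) c))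
                  / l2_norm (u + orth_proj (mat_kernel \<Omega>) c)
                = l1_norm (row_submatrix \<Omega> S *\<^sub>v u)
                  / l2_norm (u + orth_proj (mat_kernel \<Omega>) c) \<and>
              vec_support (\<Omega> *\<^sub>v (u + orth_proj (mat_kernel \<Omega>) c)) \<subseteq> S \<and>
              (S = vec_support (\<Omega> *\<^sub>v w) \<longrightarrow>
                 vec_support (\<Omega> *\<^sub>v (u + orth_proj (mat_kernel \<Omega>) c)) = S) \<and>
              (\<exists>T\<ge>0. (u \<bullet> orth_proj (mat_kernel \<Omega>) c \<ge> 0 \<longrightarrow> T = 0) \<and>
                 (\<forall>s t. T \<le> s \<and> s < t \<longrightarrow>
                    l1_l2_ratio \<Omega> (x t) \<le> l1_l2_ratio \<Omega> (x s) \<and>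
                    (row_submatrix \<Omega> S *\<^sub>v u \<noteq> 0\<^sub>v (card S) \<longrightarrow>
                       l1_l2_ratio \<Omega> (x t) < l1_l2_ratio \<Omega> (x s)))) \<and>
              ((\<lambda>t. l1_l2_ratio \<Omega> (x t)) \<longlongrightarrow> 0) at_top \<and>
              (\<Omega> \<noteq> 0\<^sub>m p n \<longrightarrow>
                 ((\<lambda>t. error_estimate n (analysis_l1 \<Omega>) (x t)) \<longlongrightarrow> \<infinity>) at_top)"
    by (rule rank_deficient_signal)
next
  fix p n :: nat and \<epsilon> :: real assume "0 < \<epsilon>" "0 < n" "n < p"
  then show "\<exists>\<Omega>\<in>carrier_mat p n. \<exists>x\<in>carrier_vec n.
      tall_mat \<Omega> \<and> vec_space.rank p \<Omega> = n \<and> x \<noteq> 0\<^sub>v n \<and> l1_l2_ratio \<Omega> x < \<epsilon>"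
    by (rule exists_full_rank_tall_small_ratio)
next
  fix m k n :: nat and U V :: "real mat"
  assume "n < m" "k < n" "incomplete_unitary m n U" "complete_unitary n V"
  then interpret stacked_operator m k n U V by unfold_locales
  show "let \<Omega> = stacked_op n k U V; x = col V (n - 1); u = col U (n - 1)
        in (\<forall>\<sigma>>0. \<Omega> \<sigma> \<in> carrier_mat (m + k) n \<and> tall_mat (\<Omega> \<sigma>) \<and>
              vec_space.rank (m + k) (\<Omega> \<sigma>) = n \<and>
              x \<in> mat_kernel (row_submatrix (\<Omega> \<sigma>) {m..<m + k}) \<and> x \<noteq> 0\<^sub>v n \<and>
              vec_support (\<Omega> \<sigma> *\<^sub>v x) \<subseteq> {..<m} \<and>
              ((\<forall>i<m. u $ i \<noteq> 0) \<longrightarrow> vec_support (\<Omega> \<sigma> *\<^sub>v x) = {..<m}) \<and>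
              l1_norm (\<Omega> \<sigma> *\<^sub>v x) / l2_norm x = \<sigma> * l1_norm u) \<and>
           ((\<lambda>\<sigma>. l1_l2_ratio (\<Omega> \<sigma>) x) \<longlongrightarrow> 0) (at_right 0) \<and>
           (0 < k \<longrightarrow>
              ((\<lambda>\<sigma>. error_estimate n (analysis_l1 (\<Omega> \<sigma>)) x) \<longlongrightarrow> \<infinity>) (at_right 0))"
    unfolding Let_def
    using stacked_op_carrier tall_stacked_op rank_stacked_op last_col_V_in_mat_kernel
      last_col_V_nonzero vec_support_stacked_op stacked_op_l1_l2_ratio[unfolded l1_l2_ratio_def]
      stacked_op_ratio_tendsto_0 stacked_op_error_estimate_tendsto_infinity
    by blast
qed

end
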